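(* Let $D_1,D_3$ be non-empty sets, $X_1,X_3$ Banach spaces, and let $\mathcal F\subseteq F(D_1,X_1)$, $\mathcal W\subseteq F(D_3,X_3)$ and $\mathcal V$ be vector spaces. Let $B:\mathcal F\times\mathcal V\to\mathcal W$ be a bilinear operator and let $V\subseteq\mathcal V$, $W\subseteq\mathcal W$ be Banach spaces such that $W$ and $M_B(V,W)$ have continuous evaluations. Then $M_B(V,W)$ is a Banach space if and only if the following property holds: for every Cauchy sequence $\{f_k\}_k\subseteq M_B(V,W)$ and every $f\in F(D_1,X_1)$ such that $f_k\to f$ pointwise on $D_1$, one has $f\in\mathcal F$ and $B(f_k,v)\to B(f,v)$ pointwise on $D_3$ for all $v\in V$.
   Context: All vector spaces are over $\mathbb K=\mathbb R$ or $\mathbb C$. $F(D,X)$ is the vector space of all functions $D\to X$. The Banach spaces $V\subseteq\mathcal V$, $W\subseteq\mathcal W$ are vector subspaces carrying their own complete norms. $M_B(V,W):=\{f\in\mathcal F: B(f,v)\in W\ \forall v\in V\}$, equipped with $\|f\|_M:=\sup\{\|B(f,v)\|_W:\|v\|_V\le1\}$. A normed space $U\subseteq F(D,X)$ has continuous evaluations if for every $a\in D$ the map $U\to X$, $u\mapsto u(a)$, is continuous; saying that $M_B(V,W)$ has continuous evaluations includes that $\|\cdot\|_M$ is a (finite-valued) norm on $M_B(V,W)$. Cauchy sequences and completeness in $M_B(V,W)$ refer to $\|\cdot\|_M$. *)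

theory Defs
  imports "HOL-Analysis.Analysis" "HOL-Library.Function_Algebras"
begin

text \<open>
  The scalar field is a type of class \<^class>\<open>real_normed_field\<close>: a field extension of the reals
  with a multiplicative norm. By Ostrowski's theorem (or Gelfand--Mazur) the only such fields are,
  up to isometric isomorphism, the real and the complex numbers.

  The space of all functions from a non-empty set \<open>D\<close> to a vector space \<open>X\<close> is the type
  \<open>'d \<Rightarrow> 'x\<close>, with the pointwise additive structure of \<open>Function_Algebras\<close> and the
  pointwise scalar multiplication below.
\<close>

definition fun_scale :: "('k \<Rightarrow> 'x \<Rightarrow> 'x) \<Rightarrow> 'k \<Rightarrow> ('d \<Rightarrow> 'x) \<Rightarrow> ('d \<Rightarrow> 'x)" where
  "fun_scale s c f = (\<lambda>a. s c (f a))"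

lemma vector_space_fun_scale:
  assumes "vector_space s"
  shows "vector_space (fun_scale s)"
proof -
  interpret vector_space s by fact
  show ?thesis
    by unfold_locales
      (simp_all add: fun_scale_def fun_eq_iff scale_right_distrib scale_left_distrib)
qed

locale normed_space_on = vector_space scale
  for scale :: "'k::real_normed_field \<Rightarrow> 'u::ab_group_add \<Rightarrow> 'u" +
  fixes U :: "'u set" and N :: "'u \<Rightarrow> real"
  assumes subspace_U: "subspace U"
    and N_nonneg: "\<And>u. u \<in> U \<Longrightarrow> 0 \<le> N u"
    and N_eq_0: "\<And>u. u \<in> U \<Longrightarrow> N u = 0 \<longleftrightarrow> u = 0"
    and N_scale: "\<And>c u. u \<in> U \<Longrightarrow> N (scale c u) = norm c * N u"
    and N_triangle: "\<And>u v. u \<in> U \<Longrightarrow> v \<in> U \<Longrightarrow> N (u + v) \<le> N u + N v"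

text \<open>The value 0 outside \<open>U\<close> is irrelevant, but \<^locale>\<open>Metric_space\<close> demands that
  the distance be non-negative and symmetric on the whole type.\<close>

definition norm_dist :: "'u::ab_group_add set \<Rightarrow> ('u \<Rightarrow> real) \<Rightarrow> 'u \<Rightarrow> 'u \<Rightarrow> real" where
  "norm_dist U N u v = (if u \<in> U \<and> v \<in> U then N (u - v) else 0)"

lemma (in normed_space_on) Metric_space_norm_dist: "Metric_space U (norm_dist U N)"
proof
  have diff: "u - v \<in> U" if "u \<in> U" "v \<in> U" for u v
    using subspace_U that by (rule subspace_diff)
  fix u v w
  show "0 \<le> norm_dist U N u v"
    by (simp add: norm_dist_def N_nonneg diff)
  have "N (u - v) = N (v - u)" if "u \<in> U" "v \<in> U"
    using N_scale[of "v - u" "-1"] diff[of v u] that by simp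
  then show "norm_dist U N u v = norm_dist U N v u"
    by (simp add: norm_dist_def)
  show "norm_dist U N u v = 0 \<longleftrightarrow> u = v" if "u \<in> U" "v \<in> U"
    using that by (simp add: norm_dist_def N_eq_0 diff)
  show "norm_dist U N u w \<le> norm_dist U N u v + norm_dist U N v w"
    if "u \<in> U" "v \<in> U" "w \<in> U"
    using that N_triangle[of "u - v" "v - w"] by (simp add: norm_dist_def diff)
qed

locale banach_space_on = normed_space_on +
  assumes complete_U: "Metric_space.mcomplete U (norm_dist U N)"

definition has_continuous_evaluations ::
    "('k::real_normed_field \<Rightarrow> 'x::real_normed_vector \<Rightarrow> 'x)
      \<Rightarrow> ('d \<Rightarrow> 'x) set \<Rightarrow> (('d \<Rightarrow> 'x) \<Rightarrow> real) \<Rightarrow> bool" where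
  "has_continuous_evaluations s U N \<longleftrightarrow>
    normed_space_on (fun_scale s) U N \<and>
    (\<forall>a. continuous_map (Metric_space.mtopology U (norm_dist U N)) euclidean (\<lambda>u. u a))"

definition bilinear_operator ::
    "('k \<Rightarrow> 'f \<Rightarrow> 'f) \<Rightarrow> ('k \<Rightarrow> 'v \<Rightarrow> 'v) \<Rightarrow> ('k \<Rightarrow> 'w \<Rightarrow> 'w)
      \<Rightarrow> 'f::ab_group_add set \<Rightarrow> 'v::ab_group_add set \<Rightarrow> 'w::ab_group_add set
      \<Rightarrow> ('f \<Rightarrow> 'v \<Rightarrow> 'w) \<Rightarrow> bool" where
  "bilinear_operator sF sV sW F V W B \<longleftrightarrow>
    (\<forall>f\<in>F. \<forall>v\<in>V. B f v \<in> W) \<and>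
    (\<forall>f\<in>F. \<forall>g\<in>F. \<forall>v\<in>V. B (f + g) v = B f v + B g v) \<and>
    (\<forall>f\<in>F. \<forall>v\<in>V. \<forall>w\<in>V. B f (v + w) = B f v + B f w) \<and>
    (\<forall>c. \<forall>f\<in>F. \<forall>v\<in>V. B (sF c f) v = sW c (B f v)) \<and>
    (\<forall>c. \<forall>f\<in>F. \<forall>v\<in>V. B f (sV c v) = sW c (B f v))"

definition multipliers :: "('f \<Rightarrow> 'v \<Rightarrow> 'w) \<Rightarrow> 'f set \<Rightarrow> 'v set \<Rightarrow> 'w set \<Rightarrow> 'f set" where
  "multipliers B F V W = {f \<in> F. \<forall>v\<in>V. B f v \<in> W}"

definition multiplier_norm_set ::
    "('f \<Rightarrow> 'v \<Rightarrow> 'w) \<Rightarrow> 'v set \<Rightarrow> ('v \<Rightarrow> real) \<Rightarrow> ('w \<Rightarrow> real) \<Rightarrow> 'f \<Rightarrow> real set" where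
  "multiplier_norm_set B V nV nW f = {nW (B f v) |v. v \<in> V \<and> nV v \<le> 1}"

text \<open>The supremum is taken in the reals, so it is meaningful only when
  \<^const>\<open>multiplier_norm_set\<close> is bounded above; finiteness has to be required separately.\<close>

definition multiplier_norm ::
    "('f \<Rightarrow> 'v \<Rightarrow> 'w) \<Rightarrow> 'v set \<Rightarrow> ('v \<Rightarrow> real) \<Rightarrow> ('w \<Rightarrow> real) \<Rightarrow> 'f \<Rightarrow> real" where
  "multiplier_norm B V nV nW f = Sup (multiplier_norm_set B V nV nW f)"

end

theory Submission
  imports Defs
begin

text \<open>
  Convergence in \<open>M\<^sub>B(V, W)\<close> is uniform convergence of the operators \<open>B(f, \<cdot>)\<close> on the unit
  ball of \<open>V\<close>. Continuity of evaluations identifies norm limits with pointwise limits, in both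
  \<open>M\<^sub>B(V, W)\<close> and \<open>W\<close>. Hence a Cauchy sequence of multipliers has a pointwise limit \<open>f\<close>, and
  completeness of \<open>W\<close> gives limits of the sequences \<open>B(f\<^sub>k, v)\<close>; the stated property is exactly
  what makes these limits equal to \<open>B(f, v)\<close>, so that \<open>f\<close> is a multiplier and the norm limit.
\<close>

section \<open>Sequential descriptions of convergence and completeness\<close>

context normed_space_on
begin

lemma MCauchy_norm_dist_iff:
  "Metric_space.MCauchy U (norm_dist U N) s \<longleftrightarrow>
    range s \<subseteq> U \<and> (\<forall>e>0. \<exists>n0. \<forall>m\<ge>n0. \<forall>n\<ge>n0. N (s m - s n) < e)"
proof -
  interpret M: Metric_space U "norm_dist U N" by (rule Metric_space_norm_dist)
  show ?thesis
  proof (cases "range s \<subseteq> U")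
    case True
    then have "norm_dist U N (s m) (s n) = N (s m - s n)" for m n
      by (auto simp: norm_dist_def)
    with True show ?thesis
      by (simp add: M.MCauchy_def)
  qed (simp add: M.MCauchy_def)
qed

lemma limitin_norm_dist_iff:
  assumes "range s \<subseteq> U"
  shows "limitin (Metric_space.mtopology U (norm_dist U N)) s l sequentially \<longleftrightarrow>
    l \<in> U \<and> (\<forall>e>0. \<exists>n0. \<forall>n\<ge>n0. N (s n - l) < e)"
proof -
  interpret M: Metric_space U "norm_dist U N" by (rule Metric_space_norm_dist)
  have s: "s n \<in> U" for n
    using assms by auto
  then have "norm_dist U N (s n) l = N (s n - l)" if "l \<in> U" for n
    using that by (simp add: norm_dist_def)
  then show ?thesis
    unfolding M.limit_metric_sequentially using s by auto
qed

text \<open>Turns completeness into an epsilon statement about \<open>N\<close> alone, so that in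
  the main argument neither the topology nor the default value of \<open>norm_dist\<close> outside
  \<open>U\<close> has to be handled.\<close>

lemma banach_space_on_iff:
  "banach_space_on scale U N \<longleftrightarrow>
    (\<forall>s :: nat \<Rightarrow> _. range s \<subseteq> U \<and> (\<forall>e>0. \<exists>n0. \<forall>m\<ge>n0. \<forall>n\<ge>n0. N (s m - s n) < e) \<longrightarrow>
      (\<exists>l\<in>U. \<forall>e>0. \<exists>n0. \<forall>n\<ge>n0. N (s n - l) < e))"
proof -
  interpret M: Metric_space U "norm_dist U N" by (rule Metric_space_norm_dist)
  have "banach_space_on scale U N \<longleftrightarrow> M.mcomplete"
    by (simp add: banach_space_on_def banach_space_on_axioms_def normed_space_on_axioms)
  also have "M.mcomplete \<longleftrightarrow>
    (\<forall>s :: nat \<Rightarrow> _. range s \<subseteq> U \<and> (\<forall>e>0. \<exists>n0. \<forall>m\<ge>n0. \<forall>n\<ge>n0. N (s m - s n) < e) \<longrightarrow>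
      (\<exists>l\<in>U. \<forall>e>0. \<exists>n0. \<forall>n\<ge>n0. N (s n - l) < e))"
  proof -
    have "(\<exists>l. limitin M.mtopology s l sequentially) \<longleftrightarrow>
        (\<exists>l\<in>U. \<forall>e>0. \<exists>n0. \<forall>n\<ge>n0. N (s n - l) < e)" if "range s \<subseteq> U" for s :: "nat \<Rightarrow> _"
      unfolding limitin_norm_dist_iff[OF that] Bex_def ..
    then show ?thesis
      unfolding M.mcomplete_def MCauchy_norm_dist_iff by (simp cong: conj_cong imp_cong)
  qed
  finally show ?thesis .
qed

end

section \<open>Passage from norms to pointwise values\<close>

lemma tendsto_evaluation:
  assumes ev: "has_continuous_evaluations s U N" and u: "range u \<subseteq> U" and l: "l \<in> U"
    and lim: "\<And>e. e > 0 \<Longrightarrow> \<exists>n0. \<forall>n\<ge>n0. N (u n - l) < e"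
  shows "(\<lambda>n. u n a) \<longlonglongrightarrow> l a"
proof -
  interpret normed_space_on "fun_scale s" U N
    using ev by (simp add: has_continuous_evaluations_def)
  have "limitin (Metric_space.mtopology U (norm_dist U N)) u l sequentially"
    unfolding limitin_norm_dist_iff[OF u] using l lim by blast
  moreover have "continuous_map (Metric_space.mtopology U (norm_dist U N)) euclidean (\<lambda>f. f a)"
    using ev by (simp add: has_continuous_evaluations_def)
  ultimately have "limitin euclidean ((\<lambda>f. f a) \<circ> u) (l a) sequentially"
    by (intro continuous_map_limit)
  then show ?thesis
    by (simp add: o_def)
qed

text \<open>Evaluation at \<open>a\<close> is additive, so its continuity at 0 is already uniform: a
  radius \<open>r\<close> for which \<open>N f < r\<close> forces \<open>norm (f a) < e\<close> can
  be applied to every difference \<open>u m - u n\<close>.\<close>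

lemma Cauchy_evaluation:
  assumes ev: "has_continuous_evaluations s U N" and u: "range u \<subseteq> U"
    and Cauchy: "\<And>e. e > 0 \<Longrightarrow> \<exists>n0. \<forall>m\<ge>n0. \<forall>n\<ge>n0. N (u m - u n) < e"
  shows "Cauchy (\<lambda>n. u n a)"
proof (rule CauchyI)
  fix e :: real assume e: "e > 0"
  interpret normed_space_on "fun_scale s" U N
    using ev by (simp add: has_continuous_evaluations_def)
  interpret M: Metric_space U "norm_dist U N" by (rule Metric_space_norm_dist)
  have U0: "0 \<in> U"
    using subspace_U by (rule subspace_0)
  have "continuous_map M.mtopology euclidean (\<lambda>f. f a)"
    using ev by (simp add: has_continuous_evaluations_def)
  then have "openin M.mtopology {f \<in> U. f a \<in> ball 0 e}"
    using openin_continuous_map_preimage[of M.mtopology euclidean "\<lambda>f. f a" "ball 0 e"]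
    by simp
  then obtain r where r: "r > 0" "M.mball 0 r \<subseteq> {f \<in> U. f a \<in> ball 0 e}"
    using e U0 unfolding M.openin_mtopology by auto
  have small: "norm (f a) < e" if "f \<in> U" "N f < r" for f
  proof -
    \<comment> \<open>Membership in the ball bounds \<open>N (0 - f)\<close>; symmetry of the
      distance turns this into \<open>N f\<close>.\<close>
    have "norm_dist U N 0 f = norm_dist U N f 0"
      by (rule M.commute)
    then have "f \<in> M.mball 0 r"
      using that U0 by (simp add: norm_dist_def)
    then show ?thesis
      using r by auto
  qed
  obtain n0 where n0: "\<And>m n. m \<ge> n0 \<Longrightarrow> n \<ge> n0 \<Longrightarrow> N (u m - u n) < r"
    using Cauchy[OF r(1)] by blast
  have "norm (u m a - u n a) < e" if "m \<ge> n0" "n \<ge> n0" for m n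
  proof -
    have "u m - u n \<in> U"
      using subspace_diff[OF subspace_U] u by blast
    then show ?thesis
      using small[of "u m - u n"] n0[OF that] by simp
  qed
  then show "\<exists>n0. \<forall>m\<ge>n0. \<forall>n\<ge>n0. norm (u m a - u n a) < e"
    by blast
qed

section \<open>Estimates for bilinear operators and the multiplier norm\<close>

lemma bilinear_operator_diff_left:
  assumes "bilinear_operator sF sV sW F V W B" and "f - g \<in> F" "g \<in> F" "v \<in> V"
  shows "B (f - g) v = B f v - B g v"
proof -
  have "B ((f - g) + g) v = B (f - g) v + B g v"
    using assms(1)[unfolded bilinear_operator_def, THEN conjunct2, THEN conjunct1] assms(2-) by blast
  then show ?thesis
    by simp
qed

lemma bilinear_operator_zero_right:
  assumes "bilinear_operator sF sV sW F V W B" and "f \<in> F" "0 \<in> V"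
  shows "B f 0 = 0"
proof -
  have "B f (0 + 0) = B f 0 + B f 0"
    using assms(1)[unfolded bilinear_operator_def, THEN conjunct2, THEN conjunct2, THEN conjunct1]
      assms(2-) by blast
  then show ?thesis
    by simp
qed

text \<open>By homogeneity in \<open>v\<close> it suffices to normalise \<open>v\<close> to length
  1, where the value is an element of the set whose supremum is taken. Boundedness of that set makes
  the real \<open>Sup\<close> an upper bound.\<close>

lemma multiplier_norm_bound:
  assumes B: "bilinear_operator sF sV sW F \<V> \<W> B" and "V \<subseteq> \<V>"
    and V: "normed_space_on sV V nV" and W: "normed_space_on sW W nW"
    and f: "f \<in> multipliers B F V W" and bdd: "bdd_above (multiplier_norm_set B V nV nW f)"
    and v: "v \<in> V"
  shows "nW (B f v) \<le> multiplier_norm B V nV nW f * nV v"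
proof -
  interpret V: normed_space_on sV V nV by fact
  interpret W: normed_space_on sW W nW by fact
  have fF: "f \<in> F" and Bf: "B f v \<in> W"
    using f v by (auto simp: multipliers_def)
  have v': "v \<in> \<V>"
    using v \<open>V \<subseteq> \<V>\<close> by auto
  show ?thesis
  proof (cases "v = 0")
    case True
    then have "B f v = 0"
      using bilinear_operator_zero_right[OF B fF] v' by simp
    then show ?thesis
      using True v V.N_eq_0[of v] W.N_eq_0[OF Bf] by simp
  next
    case False
    then have pos: "nV v > 0"
      using V.N_nonneg[OF v] V.N_eq_0[OF v] by simp
    \<comment> \<open>The real factor 1 / \<open>nV v\<close> is embedded into the scalar field,
      since \<open>sV\<close> scales by field elements only.\<close>
    define c :: 'a where "c = of_real (inverse (nV v))"
    have c: "norm c = inverse (nV v)"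
      using pos by (simp add: c_def norm_inverse)
    have cv: "sV c v \<in> V"
      using V.subspace_scale[OF V.subspace_U v] .
    have "nV (sV c v) = 1"
      using V.N_scale[OF v, of c] c pos by simp
    then have "nW (B f (sV c v)) \<in> multiplier_norm_set B V nV nW f"
      using cv by (auto simp: multiplier_norm_set_def)
    then have "nW (B f (sV c v)) \<le> multiplier_norm B V nV nW f"
      unfolding multiplier_norm_def using bdd by (rule cSup_upper)
    moreover have "B f (sV c v) = sW c (B f v)"
      using B[unfolded bilinear_operator_def] fF v' by simp
    ultimately have "inverse (nV v) * nW (B f v) \<le> multiplier_norm B V nV nW f"
      using W.N_scale[OF Bf, of c] c by simp
    then show ?thesis
      using pos by (simp add: field_simps)
  qed
qed

text \<open>The zero vector lies in the unit ball, so the supremum is over a non-empty set and any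
  upper bound dominates it.\<close>

lemma multiplier_norm_le:
  assumes "normed_space_on sV V nV"
    and bound: "\<And>v. v \<in> V \<Longrightarrow> nV v \<le> 1 \<Longrightarrow> nW (B f v) \<le> e"
  shows "multiplier_norm B V nV nW f \<le> e"
proof -
  interpret V: normed_space_on sV V nV by fact
  have V0: "0 \<in> V"
    using V.subspace_U by (rule V.subspace_0)
  then have "nV 0 = 0"
    using V.N_eq_0 by blast
  with V0 have "multiplier_norm_set B V nV nW f \<noteq> {}"
    unfolding multiplier_norm_set_def by force
  then show ?thesis
    unfolding multiplier_norm_def
    by (rule cSup_least) (auto simp: multiplier_norm_set_def bound)
qed

section \<open>Completeness of the multiplier space\<close>

theorem theorem3p1:
  fixes s1 :: "'k::real_normed_field \<Rightarrow> 'x1::banach \<Rightarrow> 'x1"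
    and s3 :: "'k \<Rightarrow> 'x3::banach \<Rightarrow> 'x3"
    and sV :: "'k \<Rightarrow> 'v::ab_group_add \<Rightarrow> 'v"
    and \<F> :: "('d1 \<Rightarrow> 'x1) set"
    and \<V> V :: "'v set"
    and \<W> W :: "('d3 \<Rightarrow> 'x3) set"
    and nV :: "'v \<Rightarrow> real"
    and nW :: "('d3 \<Rightarrow> 'x3) \<Rightarrow> real"
    and B :: "('d1 \<Rightarrow> 'x1) \<Rightarrow> 'v \<Rightarrow> ('d3 \<Rightarrow> 'x3)"
  defines "M \<equiv> multipliers B \<F> V W"
    and "nM \<equiv> multiplier_norm B V nV nW"
  assumes X1: "banach_space_on s1 UNIV norm"
    and X3: "banach_space_on s3 UNIV norm"
    and F: "module.subspace (fun_scale s1) \<F>"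
    and W_outer: "module.subspace (fun_scale s3) \<W>"
    and V_outer: "vector_space sV" "module.subspace sV \<V>"
    and B: "bilinear_operator (fun_scale s1) sV (fun_scale s3) \<F> \<V> \<W> B"
    and V: "V \<subseteq> \<V>" "banach_space_on sV V nV"
    and W: "W \<subseteq> \<W>" "banach_space_on (fun_scale s3) W nW"
    and W_eval: "has_continuous_evaluations s3 W nW"
    and M_finite: "\<And>f. f \<in> M \<Longrightarrow> bdd_above (multiplier_norm_set B V nV nW f)"
    and M_eval: "has_continuous_evaluations s1 M nM"
  shows "banach_space_on (fun_scale s1) M nM \<longleftrightarrow>
    (\<forall>fk f. Metric_space.MCauchy M (norm_dist M nM) fk \<and> (\<forall>a. (\<lambda>k. fk k a) \<longlonglongrightarrow> f a) \<longrightarrow>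
      f \<in> \<F> \<and> (\<forall>v\<in>V. \<forall>b. (\<lambda>k. B (fk k) v b) \<longlonglongrightarrow> B f v b))"
proof -
  interpret V: normed_space_on sV V nV
    using V(2) by (rule banach_space_on.axioms)
  interpret W: normed_space_on "fun_scale s3" W nW
    using W(2) by (rule banach_space_on.axioms)
  interpret M: normed_space_on "fun_scale s1" M nM
    using M_eval by (simp add: has_continuous_evaluations_def)
  have MF: "f \<in> \<F>" if "f \<in> M" for f
    using that by (simp add: M_def multipliers_def)
  have BW: "B f v \<in> W" if "f \<in> M" "v \<in> V" for f v
    using that by (simp add: M_def multipliers_def)
  have M_diff: "f - g \<in> M" if "f \<in> M" "g \<in> M" for f g
    using M.subspace_diff[OF M.subspace_U] that .
  have bound: "nW (B f v - B g v) \<le> nM (f - g) * nV v" if "f \<in> M" "g \<in> M" "v \<in> V" for f g v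
  proof -
    have fg: "f - g \<in> M"
      using M_diff that by simp
    have v: "v \<in> \<V>"
      using \<open>v \<in> V\<close> V(1) by auto
    have "B (f - g) v = B f v - B g v"
      by (rule bilinear_operator_diff_left[OF B MF[OF fg] MF[OF \<open>g \<in> M\<close>] v])
    moreover have "nW (B (f - g) v) \<le> nM (f - g) * nV v"
      unfolding nM_def
      by (rule multiplier_norm_bound[OF B V(1) V.normed_space_on_axioms W.normed_space_on_axioms
            fg[unfolded M_def] M_finite[OF fg] \<open>v \<in> V\<close>])
    ultimately show ?thesis
      by simp
  qed
  \<comment> \<open>The summand 1 in the denominator keeps the threshold positive when
    \<open>nV v\<close> = 0 and makes the final inequality strict.\<close>
  have small: "nW (B f v - B g v) < e"
    if "f \<in> M" "g \<in> M" "v \<in> V" "nM (f - g) < e / (nV v + 1)" "e > 0" for f g v e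
  proof -
    have nV: "nV v \<ge> 0"
      using V.N_nonneg that by blast
    have "nW (B f v - B g v) \<le> nM (f - g) * nV v"
      using bound that by simp
    also have "\<dots> \<le> e / (nV v + 1) * nV v"
      using that nV by (intro mult_right_mono) auto
    also have "\<dots> < e"
      using nV that by (simp add: field_simps)
    finally show ?thesis .
  qed
  show ?thesis
  proof (intro iffI allI impI, elim conjE)
    fix u f
    assume "banach_space_on (fun_scale s1) M nM" "Metric_space.MCauchy M (norm_dist M nM) u"
      and f: "\<forall>a. (\<lambda>k. u k a) \<longlonglongrightarrow> f a"
    then obtain g where uM: "range u \<subseteq> M" and g: "g \<in> M"
      and lim: "\<And>e. e > 0 \<Longrightarrow> \<exists>n0. \<forall>n\<ge>n0. nM (u n - g) < e"
      unfolding M.banach_space_on_iff M.MCauchy_norm_dist_iff by metis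
    \<comment> \<open>Norm convergence to \<open>g\<close> implies pointwise convergence to
      \<open>g\<close>, and pointwise limits are unique. So the given \<open>f\<close> is itself the
      norm limit.\<close>
    have "f = g"
      using tendsto_evaluation[OF M_eval uM g lim] f LIMSEQ_unique by blast
    then have fM: "f \<in> M" and lim: "\<And>e. e > 0 \<Longrightarrow> \<exists>n0. \<forall>n\<ge>n0. nM (u n - f) < e"
      using g lim by auto
    have "(\<lambda>k. B (u k) v b) \<longlonglongrightarrow> B f v b" if v: "v \<in> V" for v b
    proof (rule tendsto_evaluation[OF W_eval])
      show "range (\<lambda>k. B (u k) v) \<subseteq> W"
        using BW uM v by auto
      show "B f v \<in> W"
        using BW fM v .
      fix e :: real assume e: "e > 0"
      then have "e / (nV v + 1) > 0"
        using V.N_nonneg[OF v] by simp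
      then show "\<exists>n0. \<forall>n\<ge>n0. nW (B (u n) v - B f v) < e"
        using lim small[OF _ fM v _ e] uM by (meson range_subsetD)
    qed
    then show "f \<in> \<F> \<and> (\<forall>v\<in>V. \<forall>b. (\<lambda>k. B (u k) v b) \<longlonglongrightarrow> B f v b)"
      using MF fM by blast
  next
    assume closed: "\<forall>fk f. Metric_space.MCauchy M (norm_dist M nM) fk \<and>
        (\<forall>a. (\<lambda>k. fk k a) \<longlonglongrightarrow> f a) \<longrightarrow>
      f \<in> \<F> \<and> (\<forall>v\<in>V. \<forall>b. (\<lambda>k. B (fk k) v b) \<longlonglongrightarrow> B f v b)"
    show "banach_space_on (fun_scale s1) M nM"
      unfolding M.banach_space_on_iff
    proof (intro allI impI, elim conjE)
      fix u :: "nat \<Rightarrow> _" assume uM: "range u \<subseteq> M"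
        and "\<forall>e>0. \<exists>n0. \<forall>m\<ge>n0. \<forall>n\<ge>n0. nM (u m - u n) < e"
      then have Cauchy: "\<And>e. e > 0 \<Longrightarrow> \<exists>n0. \<forall>m\<ge>n0. \<forall>n\<ge>n0. nM (u m - u n) < e"
        by blast
      have u: "u n \<in> M" for n
        using uM by auto
      \<comment> \<open>These limits exist: each sequence of values is Cauchy in a Banach
        space.\<close>
      define f where "f a = lim (\<lambda>n. u n a)" for a
      have "(\<lambda>n. u n a) \<longlonglongrightarrow> f a" for a
        unfolding f_def
        using Cauchy_evaluation[OF M_eval uM Cauchy] Cauchy_convergent convergent_LIMSEQ_iff by blast
      moreover have "Metric_space.MCauchy M (norm_dist M nM) u"
        unfolding M.MCauchy_norm_dist_iff using uM Cauchy by blast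
      ultimately have fF: "f \<in> \<F>"
        and Bf: "\<And>v b. v \<in> V \<Longrightarrow> (\<lambda>k. B (u k) v b) \<longlonglongrightarrow> B f v b"
        using closed by blast+
      \<comment> \<open>Completeness of \<open>W\<close> yields a norm limit \<open>w\<close> of the
        images of \<open>v\<close>. It is also their pointwise limit, which by the assumed property
        is \<open>B f v\<close>; hence \<open>B f v\<close> belongs to \<open>W\<close>.\<close>
      have B_lim: "B f v \<in> W \<and> (\<forall>e>0. \<exists>n0. \<forall>n\<ge>n0. nW (B (u n) v - B f v) < e)"
        if v: "v \<in> V" for v
      proof -
        have BuW: "range (\<lambda>k. B (u k) v) \<subseteq> W"
          using BW u v by auto
        have "\<exists>n0. \<forall>m\<ge>n0. \<forall>n\<ge>n0. nW (B (u m) v - B (u n) v) < e" if e: "e > 0" for e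
        proof -
          have "e / (nV v + 1) > 0"
            using e V.N_nonneg[OF v] by simp
          then show ?thesis
            using Cauchy small[OF u u v _ e] by meson
        qed
        then obtain w where w: "w \<in> W"
          and lim: "\<And>e. e > 0 \<Longrightarrow> \<exists>n0. \<forall>n\<ge>n0. nW (B (u n) v - w) < e"
          using W(2)[unfolded W.banach_space_on_iff, rule_format, of "\<lambda>k. B (u k) v"] BuW by blast
        have "w = B f v"
          using tendsto_evaluation[OF W_eval BuW w lim] Bf[OF v] LIMSEQ_unique by blast
        then show ?thesis
          using w lim by blast
      qed
      have fM: "f \<in> M"
        using fF B_lim by (simp add: M_def multipliers_def)
      \<comment> \<open>The convergence just shown is for each \<open>v\<close> separately. The
        Cauchy condition in \<open>nM\<close> makes it uniform on the unit ball.\<close>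
      have "\<exists>n0. \<forall>n\<ge>n0. nM (u n - f) < e" if e: "e > 0" for e
      proof -
        \<comment> \<open>Two quarters give \<open>e / 2\<close>: passing to the supremum keeps only
          a weak inequality, so room is left for a strict bound by \<open>e\<close>.\<close>
        obtain n0 where n0: "\<And>m n. m \<ge> n0 \<Longrightarrow> n \<ge> n0 \<Longrightarrow> nM (u m - u n) < e / 4"
          using Cauchy[of "e / 4"] e by auto
        have "nM (u n - f) \<le> e / 2" if n: "n \<ge> n0" for n
          unfolding nM_def
        proof (rule multiplier_norm_le[OF V.normed_space_on_axioms])
          fix v assume v: "v \<in> V" "nV v \<le> 1"
          obtain n1 where n1: "\<And>m. m \<ge> n1 \<Longrightarrow> nW (B (u m) v - B f v) < e / 4"
            using B_lim[OF v(1)] e by (meson divide_pos_pos zero_less_numeral)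
          \<comment> \<open>The intermediate index may depend on \<open>v\<close>, because it no
            longer occurs in the resulting bound; \<open>n0\<close> was fixed before
            \<open>v\<close>.\<close>
          define m where "m = max n0 n1"
          have "nW (B (u n) v - B (u m) v) \<le> nM (u n - u m) * nV v"
            using bound[OF u u v(1)] .
          also have "\<dots> \<le> nM (u n - u m) * 1"
            using v M.N_nonneg[OF M_diff[OF u u]] by (intro mult_left_mono) auto
          also have "\<dots> < e / 4"
            using n0[of n m] n by (simp add: m_def)
          finally have "nW (B (u n) v - B (u m) v) < e / 4" .
          moreover have "nW (B (u m) v - B f v) < e / 4"
            using n1 by (simp add: m_def)
          moreover have "nW ((B (u n) v - B (u m) v) + (B (u m) v - B f v))
              \<le> nW (B (u n) v - B (u m) v) + nW (B (u m) v - B f v)"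
            by (intro W.N_triangle W.subspace_diff[OF W.subspace_U] BW u fM v)
          moreover have "B (u n - f) v = B (u n) v - B f v"
            using bilinear_operator_diff_left[OF B MF[OF M_diff[OF u fM]] MF[OF fM]] v V(1) by blast
          ultimately show "nW (B (u n - f) v) \<le> e / 2"
            by simp
        qed
        then show ?thesis
          using e by (intro exI[of _ n0]) fastforce
      qed
      then show "\<exists>l\<in>M. \<forall>e>0. \<exists>n0. \<forall>n\<ge>n0. nM (u n - l) < e"
        using fM by blast
    qed
  qed
qed

end
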